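(* Let $\mathcal{G}_{6,3}$ be the real Lie algebra with basis $x_1,\dots,x_6$ and nonzero brackets $[x_1,x_2]=x_4$, $[x_1,x_3]=x_5$, $[x_2,x_3]=x_6$. Every complex structure on $\mathcal{G}_{6,3}$ is equivalent to $$J_0=\mathrm{diag}\left(\begin{pmatrix}0&-1\\1&0\end{pmatrix},\begin{pmatrix}0&-1\\1&0\end{pmatrix},\begin{pmatrix}0&-1\\1&0\end{pmatrix}\right).$$ Hence the set $\mathfrak{X}_{6,3}$ of all complex structures on $\mathcal{G}_{6,3}$ is the single $\mathrm{Aut}(\mathcal{G}_{6,3})$-orbit of $J_0$, and $\mathfrak{X}_{6,3}$ is a submanifold of dimension 12 of $\mathbb{R}^{36}$.
   Context: Brackets of basis vectors not listed (and not obtained by antisymmetry) are zero. A complex structure on a real Lie algebra $\mathfrak{g}$ is a linear map $J:\mathfrak{g}\to\mathfrak{g}$ with $J^2=-1$ and $[JX,JY]-[X,Y]-J[JX,Y]-J[X,JY]=0$ for all $X,Y\in\mathfrak{g}$. $J$ is identified with its $6\times 6$ matrix $(\xi^k_j)$ ($k$ the row index, $j$ the column index) in the basis $(x_j)$, i.e. $Jx_j=\sum_k\xi^k_j x_k$; so the set of complex structures is a subset of $\mathbb{R}^{36}$. "Submanifold" means smooth ($C^\infty$) submanifold. $\mathrm{Aut}(\mathfrak{g})$ acts on complex structures by $J\mapsto\Phi^{-1}J\Phi$, and two complex structures are equivalent if they lie in the same orbit. $\mathrm{diag}$ denotes a block-diagonal matrix. *)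

theory Defs
  imports "HOL-Analysis.Analysis"
begin

definition lie_bracket :: "('v::real_vector \<Rightarrow> 'v \<Rightarrow> 'v) \<Rightarrow> bool" where
  "lie_bracket br \<longleftrightarrow>
     (\<forall>x. linear (br x)) \<and> (\<forall>y. linear (\<lambda>x. br x y)) \<and> (\<forall>x. br x x = 0) \<and>
     (\<forall>x y z. br x (br y z) + br y (br z x) + br z (br x y) = 0)"

definition lie_automorphisms :: "('v::real_vector \<Rightarrow> 'v \<Rightarrow> 'v) \<Rightarrow> ('v \<Rightarrow> 'v) set" where
  "lie_automorphisms br =
     {\<Phi>. linear \<Phi> \<and> bij \<Phi> \<and> (\<forall>x y. \<Phi> (br x y) = br (\<Phi> x) (\<Phi> y))}"

definition complex_structure :: "('v::real_vector \<Rightarrow> 'v \<Rightarrow> 'v) \<Rightarrow> ('v \<Rightarrow> 'v) \<Rightarrow> bool" where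
  "complex_structure br J \<longleftrightarrow>
     linear J \<and> (\<forall>x. J (J x) = - x) \<and>
     (\<forall>x y. br (J x) (J y) - br x y - J (br (J x) y) - J (br x (J y)) = 0)"

definition aut_orbit :: "('v::real_vector \<Rightarrow> 'v \<Rightarrow> 'v) \<Rightarrow> ('v \<Rightarrow> 'v) \<Rightarrow> ('v \<Rightarrow> 'v) set" where
  "aut_orbit br J = {inv \<Phi> \<circ> J \<circ> \<Phi> | \<Phi>. \<Phi> \<in> lie_automorphisms br}"

definition equivalent_structures ::
    "('v::real_vector \<Rightarrow> 'v \<Rightarrow> 'v) \<Rightarrow> ('v \<Rightarrow> 'v) \<Rightarrow> ('v \<Rightarrow> 'v) \<Rightarrow> bool" where
  "equivalent_structures br J J' \<longleftrightarrow>
     (\<exists>K. complex_structure br K \<and> J \<in> aut_orbit br K \<and> J' \<in> aut_orbit br K)"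

text \<open>
  The underlying space is \<open>real ^ 6\<close> with its standard basis as \<open>x\<^sub>1, \<dots>, x\<^sub>6\<close>.  The index type
  \<open>6\<close> is the integers modulo 6, so the index written \<open>6\<close> is the element \<open>0\<close>.
\<close>

abbreviation basis_vec :: "6 \<Rightarrow> real ^ 6" ("\<x>") where
  "basis_vec i \<equiv> axis i 1"

definition g63_bracket :: "real ^ 6 \<Rightarrow> real ^ 6 \<Rightarrow> real ^ 6" where
  "g63_bracket u v =
     (u $ 1 * v $ 2 - u $ 2 * v $ 1) *\<^sub>R \<x> 4 +
     (u $ 1 * v $ 3 - u $ 3 * v $ 1) *\<^sub>R \<x> 5 +
     (u $ 2 * v $ 3 - u $ 3 * v $ 2) *\<^sub>R \<x> 6"

lemma exhaust_6: "i = 1 \<or> i = 2 \<or> i = 3 \<or> i = 4 \<or> i = 5 \<or> i = 6" for i :: 6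
proof (induct i)
  case (of_int z)
  then have "z = 0 \<or> z = 1 \<or> z = 2 \<or> z = 3 \<or> z = 4 \<or> z = 5" by simp arith
  then show ?case by auto
qed

lemma forall_6: "(\<forall>i::6. P i) \<longleftrightarrow> P 1 \<and> P 2 \<and> P 3 \<and> P 4 \<and> P 5 \<and> P 6"
  by (metis exhaust_6)

lemma g63_bracket_basis:
  "g63_bracket (\<x> 1) (\<x> 2) = \<x> 4"
  "g63_bracket (\<x> 1) (\<x> 3) = \<x> 5"
  "g63_bracket (\<x> 2) (\<x> 3) = \<x> 6"
  "\<And>j. j \<in> {4, 5, 6} \<Longrightarrow> g63_bracket (\<x> i) (\<x> j) = 0"
  by (auto simp: g63_bracket_def axis_def vec_eq_iff)

lemma lie_bracket_g63: "lie_bracket g63_bracket"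
  unfolding lie_bracket_def
proof (intro conjI allI)
  fix x y z :: "real ^ 6"
  show "linear (g63_bracket x)" and "linear (\<lambda>x. g63_bracket x y)"
    by (rule linearI; simp add: g63_bracket_def algebra_simps)+
  show "g63_bracket x x = 0"
    by (simp add: g63_bracket_def)
  show "g63_bracket x (g63_bracket y z) + g63_bracket y (g63_bracket z x) +
      g63_bracket z (g63_bracket x y) = 0"
    by (simp add: g63_bracket_def axis_def)
qed

text \<open>
  \<open>matrix J $ k $ j\<close> is the \<open>k\<close>-th coordinate of \<open>J (\<x> j)\<close>: \<open>k\<close> is the row index and \<open>j\<close> the
  column index.  The space \<open>real ^ 6 ^ 6\<close> plays the role of \<open>\<real>\<^sup>3\<^sup>6\<close>.
\<close>

definition X63 :: "(real ^ 6 ^ 6) set" where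
  "X63 = matrix ` {J. complex_structure g63_bracket J}"

definition J0_mat :: "real ^ 6 ^ 6" where
  "J0_mat = vector
     [vector [0, -1, 0,  0, 0,  0],
      vector [1,  0, 0,  0, 0,  0],
      vector [0,  0, 0, -1, 0,  0],
      vector [0,  0, 1,  0, 0,  0],
      vector [0,  0, 0,  0, 0, -1],
      vector [0,  0, 0,  0, 1,  0]]"

definition J0 :: "real ^ 6 \<Rightarrow> real ^ 6" where
  "J0 v = J0_mat *v v"

lemma J0_basis:
  "J0 (\<x> 1) = \<x> 2" "J0 (\<x> 2) = - \<x> 1"
  "J0 (\<x> 3) = \<x> 4" "J0 (\<x> 4) = - \<x> 3"
  "J0 (\<x> 5) = \<x> 6" "J0 (\<x> 6) = - \<x> 5"
  unfolding J0_def matrix_vector_mult_basis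
  by (simp_all add: J0_mat_def column_def vec_eq_iff forall_6 vector_def
      axis_def)

text \<open>For open \<open>S\<close>: all iterated directional derivatives of order up to the
  given one exist and are continuous on \<open>S\<close>.  On a finite-dimensional domain this is the usual
  \<open>C\<^sup>k\<close> condition.\<close>

primrec Ck_on :: "nat \<Rightarrow> ('a::real_normed_vector \<Rightarrow> 'b::real_normed_vector) \<Rightarrow> 'a set \<Rightarrow> bool" where
  "Ck_on 0 f S \<longleftrightarrow> continuous_on S f"
| "Ck_on (Suc k) f S \<longleftrightarrow>
     (\<forall>x\<in>S. f differentiable (at x)) \<and>
     (\<forall>v. Ck_on k (\<lambda>x. frechet_derivative f (at x) v) S)"

definition smooth_on :: "('a::real_normed_vector \<Rightarrow> 'b::real_normed_vector) \<Rightarrow> 'a set \<Rightarrow> bool" where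
  "smooth_on f S \<longleftrightarrow> (\<forall>k. Ck_on k f S)"

definition diffeomorphism ::
    "'a::real_normed_vector set \<Rightarrow> 'b::real_normed_vector set \<Rightarrow> ('a \<Rightarrow> 'b) \<Rightarrow> ('b \<Rightarrow> 'a) \<Rightarrow> bool" where
  "diffeomorphism U V f g \<longleftrightarrow>
     open U \<and> open V \<and> homeomorphism U V f g \<and> smooth_on f U \<and> smooth_on g V"

text \<open>Embedded submanifolds, by slice charts: around each of its points, \<open>M\<close> is straightened to a
  linear subspace of dimension \<open>d\<close> by a diffeomorphism between open subsets of the ambient space.\<close>

definition smooth_submanifold :: "nat \<Rightarrow> 'a::euclidean_space set \<Rightarrow> bool" where
  "smooth_submanifold d M \<longleftrightarrow>
     (\<forall>p\<in>M. \<exists>(U :: 'a set) (V :: 'a set) f g L. p \<in> U \<and> diffeomorphism U V f g \<and>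
        subspace L \<and> dim L = d \<and> f ` (U \<inter> M) = V \<inter> L)"

end

theory Submission
  imports Defs
begin

text \<open>
  Since the algebra is free two-step nilpotent, any \<open>y\<^sub>1, y\<^sub>2, y\<^sub>3\<close> that are independent modulo the
  center are the images of \<open>x\<^sub>1, x\<^sub>2, x\<^sub>3\<close> under a unique automorphism.  For a complex structure
  \<open>J\<close> take \<open>y\<^sub>2 = J y\<^sub>1\<close> and \<open>y\<^sub>3 = - J [y\<^sub>1, y\<^sub>2]\<close>; integrability applied to \<open>y\<^sub>1, y\<^sub>3\<close> gives
  \<open>J [y\<^sub>1, y\<^sub>3] = [y\<^sub>2, y\<^sub>3]\<close>, so the automorphism conjugates \<open>J\<close> to \<open>J0\<close>.
  A suitable \<open>y\<^sub>1\<close> exists because \<open>J\<close> cannot preserve the three-dimensional center: choose a central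
  \<open>z\<close> with \<open>e = J z\<close> not central, and \<open>y\<^sub>1\<close> with \<open>[y\<^sub>1, e] \<noteq> 0\<close>.
  With \<open>y\<^sub>1\<close> fixed, the automorphism depends polynomially on \<open>J\<close> through the twelve numbers
  \<open>(y\<^sub>2, y\<^sub>3)\<close>, and this yields explicit rational slice charts.
\<close>

section \<open>Smooth maps on open sets\<close>

text \<open>On an open set the derivative at a point depends only on nearby values, so it agrees for
  \<open>f\<close> and \<open>g\<close>, and the induction passes to it.\<close>

lemma Ck_on_cong:
  assumes "open S" and "\<And>x. x \<in> S \<Longrightarrow> f x = g x" and "Ck_on k f S"
  shows "Ck_on k g S"
  using assms(2,3)
proof (induction k arbitrary: f g)
  case 0
  then show ?case by (simp cong: continuous_on_cong)
next
  case (Suc k)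
  have diff: "f differentiable (at x)" if "x \<in> S" for x
    using Suc.prems(2) that by simp
  have eq: "frechet_derivative f (at x) = frechet_derivative g (at x)" if "x \<in> S" for x
    using frechet_derivative_transform_within_open[OF diff[OF that] \<open>open S\<close> that] Suc.prems(1)
    by blast
  have "g differentiable (at x)" if "x \<in> S" for x
    using diff[OF that] has_derivative_transform_within_open[OF _ \<open>open S\<close> that] Suc.prems(1)
    unfolding differentiable_def by metis
  moreover have "Ck_on k (\<lambda>x. frechet_derivative g (at x) v) S" for v
    using Suc.IH[of "\<lambda>x. frechet_derivative f (at x) v"] Suc.prems(2) eq by simp
  ultimately show ?case by simp
qed

text \<open>Lets the inductions below use an explicit derivative \<open>f'\<close> in place of the
  choice-based \<open>frechet_derivative\<close>.\<close>

lemma Ck_on_SucI: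
  assumes "open S" and "\<And>x. x \<in> S \<Longrightarrow> (f has_derivative f' x) (at x)"
    and "\<And>v. Ck_on k (\<lambda>x. f' x v) S"
  shows "Ck_on (Suc k) f S"
proof -
  have "Ck_on k (\<lambda>x. frechet_derivative f (at x) v) S" for v
    by (rule Ck_on_cong[OF \<open>open S\<close> _ assms(3)[of v]])
      (use assms(2) frechet_derivative_at in metis)
  then show ?thesis
    using assms(2) by (auto simp: differentiable_def)
qed

lemma Ck_on_SucD:
  assumes "Ck_on (Suc k) f S"
  shows "\<And>x. x \<in> S \<Longrightarrow> (f has_derivative frechet_derivative f (at x)) (at x)"
    and "Ck_on k (\<lambda>x. frechet_derivative f (at x) v) S"
  using assms by (auto simp: frechet_derivative_works)

lemma Ck_on_Suc_imp: "Ck_on (Suc k) f S \<Longrightarrow> Ck_on k f S"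
proof (induction k arbitrary: f)
  case 0
  then show ?case
    by (auto simp: continuous_on_eq_continuous_within
        intro: differentiable_imp_continuous_within differentiable_at_withinI)
next
  case (Suc k)
  then show ?case by (metis Ck_on.simps(2))
qed

lemma Ck_on_const: "Ck_on k (\<lambda>x. c) S"
  by (induction k arbitrary: c) auto

lemma Ck_on_linear:
  assumes "open S" and "bounded_linear L" and "Ck_on k f S"
  shows "Ck_on k (\<lambda>x. L (f x)) S"
  using assms(3)
proof (induction k arbitrary: f)
  case 0
  then show ?case
    using assms(2) by (simp add: bounded_linear.continuous_on)
next
  case (Suc k)
  note D = Ck_on_SucD[OF Suc.prems]
  show ?case
    by (rule Ck_on_SucI[OF \<open>open S\<close> bounded_linear.has_derivative[OF assms(2) D(1)] Suc.IH[OF D(2)]])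
qed

lemma Ck_on_add:
  assumes "open S" and "Ck_on k f S" and "Ck_on k g S"
  shows "Ck_on k (\<lambda>x. f x + g x) S"
  using assms(2,3)
proof (induction k arbitrary: f g)
  case 0
  then show ?case by (simp add: continuous_on_add)
next
  case (Suc k)
  note D = Ck_on_SucD[OF Suc.prems(1)] and E = Ck_on_SucD[OF Suc.prems(2)]
  show ?case
    by (rule Ck_on_SucI[OF \<open>open S\<close> has_derivative_add[OF D(1) E(1)] Suc.IH[OF D(2) E(2)]])
qed

text \<open>By the product rule the derivative is a sum of two terms of the same bilinear shape; in
  each, the undifferentiated factor is lowered by one order with
  \<open>Ck_on_Suc_imp\<close>.\<close>

lemma Ck_on_bilinear:
  assumes "open S" and "bounded_bilinear b" and "Ck_on k f S" and "Ck_on k g S"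
  shows "Ck_on k (\<lambda>x. b (f x) (g x)) S"
  using assms(3,4)
proof (induction k arbitrary: f g)
  case 0
  then show ?case using assms(2) by (simp add: bounded_bilinear.continuous_on)
next
  case (Suc k)
  note D = Ck_on_SucD[OF Suc.prems(1)] and E = Ck_on_SucD[OF Suc.prems(2)]
  show ?case
    by (rule Ck_on_SucI[OF \<open>open S\<close> bounded_bilinear.FDERIV[OF assms(2) D(1) E(1)]
          Ck_on_add[OF \<open>open S\<close> Suc.IH[OF Ck_on_Suc_imp[OF Suc.prems(1)] E(2)]
            Suc.IH[OF D(2) Ck_on_Suc_imp[OF Suc.prems(2)]]]])
qed

text \<open>The derivative \<open>- (1/f) f' (1/f)\<close> involves \<open>1/f\<close> only
  undifferentiated, so the induction hypothesis for \<open>1/f\<close> suffices.\<close>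

lemma Ck_on_inverse:
  fixes f :: "'a::real_normed_vector \<Rightarrow> real"
  assumes "open S" and "\<And>x. x \<in> S \<Longrightarrow> f x \<noteq> 0" and "Ck_on k f S"
  shows "Ck_on k (\<lambda>x. inverse (f x)) S"
  using assms(3)
proof (induction k)
  case 0
  then show ?case using assms(2) by (auto intro: continuous_on_inverse)
next
  case (Suc k)
  note D = Ck_on_SucD[OF Suc.prems]
  have IH: "Ck_on k (\<lambda>x. inverse (f x)) S"
    using Suc Ck_on_Suc_imp by blast
  have "Ck_on k (\<lambda>x. - (inverse (f x) * frechet_derivative f (at x) v * inverse (f x))) S" for v
    by (intro Ck_on_linear[OF \<open>open S\<close> bounded_linear_minus[OF bounded_linear_ident]]
        Ck_on_bilinear[OF \<open>open S\<close> bounded_bilinear_mult] IH D(2))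
  then show ?case
    using Ck_on_SucI[OF \<open>open S\<close> Deriv.has_derivative_inverse[OF assms(2) D(1)]] by blast
qed

lemma smooth_on_const: "smooth_on (\<lambda>x. c) S"
  by (simp add: smooth_on_def Ck_on_const)

lemma smooth_on_ident:
  assumes "open S" shows "smooth_on (\<lambda>x. x) S"
proof -
  have "Ck_on k (\<lambda>x. x) S" for k
    by (cases k) (use assms in \<open>auto simp: Ck_on_const\<close>)
  then show ?thesis by (simp add: smooth_on_def)
qed

lemma smooth_on_linear:
  "open S \<Longrightarrow> bounded_linear L \<Longrightarrow> smooth_on f S \<Longrightarrow> smooth_on (\<lambda>x. L (f x)) S"
  by (simp add: smooth_on_def Ck_on_linear)

lemma smooth_on_add:
  "open S \<Longrightarrow> smooth_on f S \<Longrightarrow> smooth_on g S \<Longrightarrow> smooth_on (\<lambda>x. f x + g x) S"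
  by (simp add: smooth_on_def Ck_on_add)

lemma smooth_on_uminus: "open S \<Longrightarrow> smooth_on f S \<Longrightarrow> smooth_on (\<lambda>x. - f x) S"
  by (rule smooth_on_linear[OF _ bounded_linear_minus[OF bounded_linear_ident]])

lemma smooth_on_diff:
  "open S \<Longrightarrow> smooth_on f S \<Longrightarrow> smooth_on g S \<Longrightarrow> smooth_on (\<lambda>x. f x - g x) S"
  using smooth_on_add[of S f "\<lambda>x. - g x"] smooth_on_uminus[of S g] by simp

lemma smooth_on_bilinear:
  "open S \<Longrightarrow> bounded_bilinear b \<Longrightarrow> smooth_on f S \<Longrightarrow> smooth_on g S
    \<Longrightarrow> smooth_on (\<lambda>x. b (f x) (g x)) S"
  by (simp add: smooth_on_def Ck_on_bilinear)

lemma smooth_on_mult: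
  fixes f g :: "'a::real_normed_vector \<Rightarrow> real"
  shows "open S \<Longrightarrow> smooth_on f S \<Longrightarrow> smooth_on g S \<Longrightarrow> smooth_on (\<lambda>x. f x * g x) S"
  by (rule smooth_on_bilinear[OF _ bounded_bilinear_mult])

lemma smooth_on_inverse:
  fixes f :: "'a::real_normed_vector \<Rightarrow> real"
  shows "open S \<Longrightarrow> (\<And>x. x \<in> S \<Longrightarrow> f x \<noteq> 0) \<Longrightarrow> smooth_on f S \<Longrightarrow> smooth_on (\<lambda>x. inverse (f x)) S"
  by (simp add: smooth_on_def Ck_on_inverse)

lemma smooth_on_cong:
  "open S \<Longrightarrow> (\<And>x. x \<in> S \<Longrightarrow> f x = g x) \<Longrightarrow> smooth_on f S \<Longrightarrow> smooth_on g S"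
  unfolding smooth_on_def using Ck_on_cong by blast

lemma smooth_on_imp_continuous_on: "smooth_on f S \<Longrightarrow> continuous_on S f"
  unfolding smooth_on_def using Ck_on.simps(1) by blast

lemma smooth_on_sum:
  assumes "open S" and "\<And>i. i \<in> I \<Longrightarrow> smooth_on (f i) S"
  shows "smooth_on (\<lambda>x. \<Sum>i\<in>I. f i x) S"
  using assms(2)
  by (induction I rule: infinite_finite_induct) (simp_all add: smooth_on_const smooth_on_add assms(1))

lemma smooth_on_prod:
  fixes f :: "'i \<Rightarrow> 'a::real_normed_vector \<Rightarrow> real"
  assumes "open S" and "\<And>i. i \<in> I \<Longrightarrow> smooth_on (f i) S"
  shows "smooth_on (\<lambda>x. \<Prod>i\<in>I. f i x) S"
  using assms(2)
  by (induction I rule: infinite_finite_induct)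
    (simp_all add: smooth_on_const smooth_on_mult assms(1))

lemma smooth_on_vec:
  fixes f :: "'a::real_normed_vector \<Rightarrow> 'b::euclidean_space ^ 'n::finite"
  assumes "open S" and "\<And>i. smooth_on (\<lambda>x. f x $ i) S"
  shows "smooth_on f S"
proof (rule smooth_on_cong[OF assms(1)])
  have "bounded_linear (axis i :: 'b \<Rightarrow> 'b ^ 'n)" for i
    unfolding linear_conv_bounded_linear[symmetric]
    by (rule linearI) (auto simp: axis_def vec_eq_iff)
  then show "smooth_on (\<lambda>x. \<Sum>i\<in>UNIV. axis i (f x $ i)) S"
    by (intro smooth_on_sum[OF assms(1)] smooth_on_linear[OF assms(1) _ assms(2)])
  show "(\<Sum>i\<in>UNIV. axis i (f x $ i)) = f x" for x
    by (simp add: vec_eq_iff axis_def if_distrib[where f="\<lambda>g. g $ _"] sum.delta cong: if_cong)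
qed

lemma smooth_on_nth:
  fixes f :: "'a::real_normed_vector \<Rightarrow> 'b::real_normed_vector ^ 'n::finite"
  shows "open S \<Longrightarrow> smooth_on f S \<Longrightarrow> smooth_on (\<lambda>x. f x $ i) S"
  by (rule smooth_on_linear[OF _ bounded_linear_vec_nth])

lemma smooth_on_det:
  fixes F :: "'a::real_normed_vector \<Rightarrow> real ^ 'n ^ 'n::finite"
  assumes "open S" and "\<And>i j. smooth_on (\<lambda>x. F x $ i $ j) S"
  shows "smooth_on (\<lambda>x. det (F x)) S"
  unfolding det_def
  by (intro smooth_on_sum smooth_on_prod smooth_on_mult smooth_on_const assms)

section \<open>Matrix inversion and matrix products as smooth operations\<close>

lemma matrix_inv_mult:
  fixes A :: "real ^ 'n ^ 'n::finite"
  assumes "det A \<noteq> 0"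
  shows "A ** matrix_inv A = mat 1" and "matrix_inv A ** A = mat 1"
proof -
  have "\<exists>B. A ** B = mat 1 \<and> B ** A = mat 1"
    using assms unfolding invertible_det_nz[symmetric] invertible_def .
  from someI_ex[OF this] show "A ** matrix_inv A = mat 1" and "matrix_inv A ** A = mat 1"
    unfolding matrix_inv_def by auto
qed

text \<open>Cramer's rule for the \<open>j\<close>-th column of the inverse: the entries become
  quotients of polynomials in the entries of \<open>A\<close>, hence smooth where
  \<open>det A\<close> is nonzero.\<close>

lemma matrix_inv_nth:
  fixes A :: "real ^ 'n ^ 'n::finite"
  assumes "det A \<noteq> 0"
  shows "matrix_inv A $ k $ j = det (\<chi> i l. if l = k then axis j 1 $ i else A $ i $ l) / det A"
proof -
  have "A *v (matrix_inv A *v axis j 1) = axis j 1"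
    by (simp add: matrix_vector_mul_assoc matrix_inv_mult[OF assms])
  then have "matrix_inv A *v axis j 1 = (\<chi> k. det (\<chi> i l. if l = k then axis j 1 $ i else A $ i $ l) / det A)"
    using cramer[OF assms] by blast
  then show ?thesis
    by (simp add: matrix_vector_mult_basis column_def vec_eq_iff)
qed

lemma smooth_on_matrix_inv:
  fixes F :: "'a::real_normed_vector \<Rightarrow> real ^ 'n ^ 'n::finite"
  assumes "open S" and "smooth_on F S" and nz: "\<And>x. x \<in> S \<Longrightarrow> det (F x) \<noteq> 0"
  shows "smooth_on (\<lambda>x. matrix_inv (F x)) S"
proof (rule smooth_on_vec[OF \<open>open S\<close>], rule smooth_on_vec[OF \<open>open S\<close>])
  fix k j :: 'n
  have F: "smooth_on (\<lambda>x. F x $ i $ l) S" for i l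
    by (intro smooth_on_nth assms)
  have "smooth_on (\<lambda>x. det (\<chi> i l. if l = k then axis j 1 $ i else F x $ i $ l) * inverse (det (F x))) S"
  proof (intro smooth_on_mult smooth_on_inverse smooth_on_det F assms)
    fix i l
    show "smooth_on (\<lambda>x. (\<chi> i l. if l = k then axis j 1 $ i else F x $ i $ l) $ i $ l) S"
      by (cases "l = k") (simp_all add: smooth_on_const F)
  qed
  then show "smooth_on (\<lambda>x. matrix_inv (F x) $ k $ j) S"
    by (rule smooth_on_cong[OF \<open>open S\<close>, rotated]) (simp add: matrix_inv_nth[OF nz] divide_inverse)
qed

lemma bounded_bilinear_matrix_mult:
  "bounded_bilinear ((**) :: real ^ 'm::finite ^ 'n::finite \<Rightarrow> real ^ 'p::finite ^ 'm \<Rightarrow> real ^ 'p ^ 'n)"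
  unfolding bilinear_conv_bounded_bilinear[symmetric] bilinear_def
  by (intro conjI allI linearI)
    (simp_all add: matrix_matrix_mult_def vec_eq_iff algebra_simps sum.distrib sum_distrib_left)

lemma bounded_bilinear_matrix_vector_mult:
  "bounded_bilinear ((*v) :: real ^ 'm::finite ^ 'n::finite \<Rightarrow> real ^ 'm \<Rightarrow> real ^ 'n)"
  unfolding bilinear_conv_bounded_bilinear[symmetric] bilinear_def
  by (intro conjI allI linearI)
    (simp_all add: matrix_vector_mult_def vec_eq_iff algebra_simps sum.distrib sum_distrib_left)

section \<open>The free two-step nilpotent Lie algebra on three generators\<close>

abbreviation br :: "real ^ 6 \<Rightarrow> real ^ 6 \<Rightarrow> real ^ 6" where "br \<equiv> g63_bracket"

lemma br_nth:
  "br u v $ 1 = 0" "br u v $ 2 = 0" "br u v $ 3 = 0"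
  "br u v $ 4 = u $ 1 * v $ 2 - u $ 2 * v $ 1"
  "br u v $ 5 = u $ 1 * v $ 3 - u $ 3 * v $ 1"
  "br u v $ 6 = u $ 2 * v $ 3 - u $ 3 * v $ 2"
  by (simp_all add: g63_bracket_def axis_def)

lemma vec6_eq_iff:
  "u = v \<longleftrightarrow> u $ 1 = v $ 1 \<and> u $ 2 = v $ 2 \<and> u $ 3 = v $ 3 \<and> u $ 4 = v $ 4 \<and> u $ 5 = v $ 5 \<and> u $ 6 = v $ 6"
  for u v :: "'a ^ 6"
  by (simp add: vec_eq_iff forall_6)

lemma basis_nth: "\<x> i $ j = (if j = i then 1 else 0)"
  by (simp add: axis_def)

lemma bounded_bilinear_br: "bounded_bilinear br"
  using lie_bracket_g63
  by (auto simp: lie_bracket_def bilinear_conv_bounded_bilinear[symmetric] bilinear_def)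

lemma linear_eq_6:
  fixes f g :: "real ^ 6 \<Rightarrow> 'a::real_vector"
  assumes "linear f" "linear g"
    and "f (\<x> 1) = g (\<x> 1)" "f (\<x> 2) = g (\<x> 2)" "f (\<x> 3) = g (\<x> 3)"
    and "f (\<x> 4) = g (\<x> 4)" "f (\<x> 5) = g (\<x> 5)" "f (\<x> 6) = g (\<x> 6)"
  shows "f = g"
proof (rule linear_eq_stdbasis[OF assms(1,2)])
  fix b :: "real ^ 6"
  assume "b \<in> Basis"
  then obtain i where "b = axis i 1" by (auto simp: Basis_vec_def)
  then show "f b = g b" using exhaust_6[of i] assms by auto
qed

definition frame :: "real ^ 6 \<Rightarrow> real ^ 6 \<Rightarrow> real ^ 6 \<Rightarrow> real ^ 6 \<Rightarrow> real ^ 6" where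
  "frame y1 y2 y3 v = v $ 1 *\<^sub>R y1 + v $ 2 *\<^sub>R y2 + v $ 3 *\<^sub>R y3
     + v $ 4 *\<^sub>R br y1 y2 + v $ 5 *\<^sub>R br y1 y3 + v $ 6 *\<^sub>R br y2 y3"

lemma linear_frame: "linear (frame y1 y2 y3)"
  by (rule linearI) (simp_all add: frame_def algebra_simps)

lemma frame_basis:
  "frame y1 y2 y3 (\<x> 1) = y1" "frame y1 y2 y3 (\<x> 2) = y2" "frame y1 y2 y3 (\<x> 3) = y3"
  "frame y1 y2 y3 (\<x> 4) = br y1 y2" "frame y1 y2 y3 (\<x> 5) = br y1 y3"
  "frame y1 y2 y3 (\<x> 6) = br y2 y3"
  by (simp_all add: frame_def axis_def)

text \<open>Central summands drop out of a bracket, so the right side expands bilinearly in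
  \<open>y1, y2, y3\<close> alone. This is the freeness of the algebra.\<close>

lemma frame_br: "frame y1 y2 y3 (br u v) = br (frame y1 y2 y3 u) (frame y1 y2 y3 v)"
  by (simp add: frame_def vec6_eq_iff br_nth algebra_simps)

text \<open>The wedge product \<open>V \<times> \<Lambda>\<^sup>2 V \<rightarrow> \<Lambda>\<^sup>3 V = \<real>\<close>, where \<open>V\<close> is spanned by the first three basis
  vectors and \<open>\<Lambda>\<^sup>2 V\<close> is the center.\<close>

definition wedge :: "real ^ 6 \<Rightarrow> real ^ 6 \<Rightarrow> real" where
  "wedge u z = u $ 1 * z $ 6 - u $ 2 * z $ 5 + u $ 3 * z $ 4"

definition central :: "real ^ 6 \<Rightarrow> bool" where
  "central z \<longleftrightarrow> z $ 1 = 0 \<and> z $ 2 = 0 \<and> z $ 3 = 0"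

lemma central_br [simp]: "central (br u v)"
  by (simp add: central_def br_nth)

lemma br_central [simp]:
  assumes "central z"
  shows "br u z = 0" and "br z u = 0"
  using assms by (simp_all add: central_def vec6_eq_iff br_nth)

text \<open>The hypothesis says that the 3x3 determinant of the \<open>y\<close>s modulo the center
  is nonzero. Wedging with a bracket of two of them isolates the coefficient of the third; once
  these vanish, wedging with a single \<open>y\<close> isolates the coefficients on the
  center.\<close>

lemma inj_frame:
  assumes nz: "wedge y1 (br y2 y3) \<noteq> 0"
  shows "inj (frame y1 y2 y3)"
proof (subst linear_injective_0[OF linear_frame], intro allI impI)
  fix v assume v: "frame y1 y2 y3 v = 0"
  let ?d = "wedge y1 (br y2 y3)"
  have "v $ 1 * ?d = wedge (frame y1 y2 y3 v) (br y2 y3)"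
    "v $ 2 * ?d = - wedge (frame y1 y2 y3 v) (br y1 y3)"
    "v $ 3 * ?d = wedge (frame y1 y2 y3 v) (br y1 y2)"
    by (simp_all add: wedge_def frame_def br_nth algebra_simps)
  then have v123: "v $ 1 = 0" "v $ 2 = 0" "v $ 3 = 0"
    using nz by (simp_all add: v wedge_def)
  have "v $ 4 * ?d = wedge y3 (frame y1 y2 y3 v)"
    "v $ 5 * ?d = - wedge y2 (frame y1 y2 y3 v)"
    "v $ 6 * ?d = wedge y1 (frame y1 y2 y3 v)"
    using v123 by (simp_all add: wedge_def frame_def br_nth algebra_simps)
  then have "v $ 4 = 0" "v $ 5 = 0" "v $ 6 = 0"
    using nz by (simp_all add: v wedge_def)
  with v123 show "v = 0" by (simp add: vec6_eq_iff)
qed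

text \<open>Modulo the center, \<open>u\<close> and \<open>w\<close> are independent and
  \<open>u, v, w\<close> are not, so \<open>v\<close> is a combination of \<open>u\<close> and
  \<open>w\<close>. Concretely, the 2x2 minors of the two brackets are coordinates of
  \<open>w\<close> times the vanishing wedge.\<close>

lemma parallel_br:
  assumes "wedge u (br v w) = 0" and "br u w \<noteq> 0"
  obtains a where "br v w = a *\<^sub>R br u w"
proof -
  have e: "br v w $ i * br u w $ j = br v w $ j * br u w $ i" for i j
  proof -
    have "br v w $ 4 * br u w $ 5 - br v w $ 5 * br u w $ 4 = - w $ 1 * wedge u (br v w)"
      "br v w $ 4 * br u w $ 6 - br v w $ 6 * br u w $ 4 = - w $ 2 * wedge u (br v w)"
      "br v w $ 5 * br u w $ 6 - br v w $ 6 * br u w $ 5 = - w $ 3 * wedge u (br v w)"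
      by (simp_all add: wedge_def br_nth algebra_simps)
    then show ?thesis
      using assms(1) exhaust_6[of i] exhaust_6[of j] by (auto simp: br_nth(1-3))
  qed
  obtain j where j: "br u w $ j \<noteq> 0" using assms(2) by (auto simp: vec_eq_iff)
  show thesis
    by (rule that[of "br v w $ j / br u w $ j"]) (use j e[of _ j] in \<open>simp add: vec_eq_iff field_simps\<close>)
qed

section \<open>Complex structures\<close>

locale g63_complex_structure =
  fixes J :: "real ^ 6 \<Rightarrow> real ^ 6"
  assumes complex_structure: "complex_structure br J"
begin

lemma lin: "linear J"
  using complex_structure by (simp add: complex_structure_def)

lemma JJ [simp]: "J (J x) = - x"
  using complex_structure by (simp add: complex_structure_def)

lemma nijenhuis: "J (br (J x) y) + J (br x (J y)) = br (J x) (J y) - br x y"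
  using complex_structure by (simp add: complex_structure_def algebra_simps)

text \<open>Since \<open>J y3 = br y1 y2\<close> is central, two terms of the integrability
  condition at \<open>y1, y3\<close> vanish, leaving the value of \<open>J\<close> on
  \<open>br y2 y3\<close>.\<close>

lemma J_frame:
  assumes "y2 = J y1" and "y3 = - J (br y1 y2)"
  shows "J (frame y1 y2 y3 v) = frame y1 y2 y3 (J0 v)"
proof -
  have Jy3: "J y3 = br y1 y2"
    using assms(2) by (simp add: linear_neg[OF lin])
  have J6: "J (br y2 y3) = - br y1 y3"
    using nijenhuis[of y1 y3] Jy3 assms(1) by (simp add: linear_0[OF lin])
  have J5: "J (br y1 y3) = br y2 y3"
    using JJ[of "br y2 y3"] unfolding J6 by (simp add: linear_neg[OF lin])
  have J12: "J y1 = y2" "J y2 = - y1" and J4: "J (br y1 y2) = - y3"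
    using assms by simp_all
  have "linear J0"
    unfolding J0_def by simp
  have "J \<circ> frame y1 y2 y3 = frame y1 y2 y3 \<circ> J0"
    by (rule linear_eq_6)
      (simp_all add: linear_compose lin linear_frame \<open>linear J0\<close> frame_basis J0_basis
        linear_neg[OF linear_frame] J12 Jy3 J4 J5 J6)
  then show ?thesis by (metis comp_apply)
qed

text \<open>Otherwise \<open>J\<close> would restrict to the center with square -1, impossible in
  odd dimension: the square of the real determinant of the restriction would be -1.\<close>

lemma ex_central_not_preserved: "\<exists>z. central z \<and> \<not> central (J z)"
proof (rule ccontr)
  assume "\<not> ?thesis"
  then have c: "central (J z)" if "central z" for z using that by blast
  define idx :: "3 \<Rightarrow> 6" where "idx i = (if i = 1 then 4 else if i = 2 then 5 else 6)" for i
  define D :: "real ^ 3 ^ 3" where "D = (\<chi> i j. J (\<x> (idx j)) $ idx i)"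
  have exp: "z = z $ 4 *\<^sub>R \<x> 4 + z $ 5 *\<^sub>R \<x> 5 + z $ 6 *\<^sub>R \<x> 6" if "central z" for z
    using that by (simp add: central_def vec6_eq_iff axis_def)
  have J3: "J z = z $ 4 *\<^sub>R J (\<x> 4) + z $ 5 *\<^sub>R J (\<x> 5) + z $ 6 *\<^sub>R J (\<x> 6)" if "central z" for z
    by (subst exp[OF that]) (simp only: linear_add[OF lin] linear_scale[OF lin])
  have "central (\<x> 4)" "central (\<x> 5)" "central (\<x> 6)"
    by (simp_all add: central_def axis_def)
  note J3' = this[THEN c, THEN J3, unfolded JJ vec6_eq_iff]
  have "D ** D = - mat 1"
    using J3'
    by (simp add: D_def matrix_matrix_mult_def mat_def vec_eq_iff[where 'b=3] forall_3 sum_3 idx_def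
        basis_nth algebra_simps)
  then have "det D * det D = det (- mat 1 :: real ^ 3 ^ 3)"
    by (metis det_mul)
  also have "\<dots> = -1" by (simp add: det_3 mat_def)
  finally show False
    using zero_le_square[of "det D"] by simp
qed

text \<open>Bracketing with a noncentral \<open>e = J z\<close>, \<open>z\<close> central, commutes
  with \<open>J\<close>. This makes \<open>y, J y, e\<close> independent modulo the center once
  \<open>br y e\<close> is nonzero. Modulo the center, \<open>e\<close> is then a multiple of
  \<open>J (br y (J y))\<close>, which can therefore replace \<open>e\<close>.\<close>

lemma ex_generator: "\<exists>y. wedge y (br (J y) (- J (br y (J y)))) \<noteq> 0"
proof -
  obtain z where z: "central z" and nc: "\<not> central (J z)"
    using ex_central_not_preserved by blast
  define e where "e = J z"
  have Je: "J (br x e) = br (J x) e" for x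
    using nijenhuis[of x z] z by (simp add: e_def linear_0[OF lin])
  \<comment> \<open>The brackets of \<open>e\<close> with these two basis vectors already contain
    its first three coordinates up to sign.\<close>
  have "br (\<x> 1) e \<noteq> 0 \<or> br (\<x> 2) e \<noteq> 0"
    using nc by (auto simp: e_def central_def vec6_eq_iff br_nth axis_def)
  then obtain y where y: "br y e \<noteq> 0" by blast
  define \<delta> where "\<delta> = wedge y (br (J y) e)"
  have \<delta>: "\<delta> \<noteq> 0"
  proof
    \<comment> \<open>Dependence would make \<open>br y e\<close> an eigenvector of \<open>J\<close>
      with real eigenvalue \<open>a\<close>, forcing \<open>a * a = -1\<close>.\<close>
    assume "\<delta> = 0"
    then obtain a where a: "br (J y) e = a *\<^sub>R br y e"
      using parallel_br y unfolding \<delta>_def by blast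
    have "- br y e = J (J (br y e))" by simp
    also have "\<dots> = (a * a) *\<^sub>R br y e"
      by (simp add: Je a linear_scale[OF lin])
    finally have sq: "- br y e = (a * a) *\<^sub>R br y e" .
    have "(a * a + 1) *\<^sub>R br y e = 0" by (simp add: scaleR_add_left flip: sq)
    then have "a * a + 1 = 0" using y by simp
    then show False using zero_le_square[of a] by linarith
  qed
  define w where "w = J (br y (J y))"
  \<comment> \<open>\<open>z\<close> in the basis \<open>[y, Jy], [y, e], [Jy, e]\<close> of the center; \<open>J\<close> keeps the last two central.\<close>
  have "\<delta> *\<^sub>R z = wedge e z *\<^sub>R br y (J y) - wedge (J y) z *\<^sub>R br y e + wedge y z *\<^sub>R br (J y) e"
    using z by (simp add: \<delta>_def vec6_eq_iff wedge_def br_nth central_def algebra_simps)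
  then have "J (\<delta> *\<^sub>R z) = J (wedge e z *\<^sub>R br y (J y) - wedge (J y) z *\<^sub>R br y e + wedge y z *\<^sub>R br (J y) e)"
    by simp
  then have "\<delta> *\<^sub>R e = wedge e z *\<^sub>R w - wedge (J y) z *\<^sub>R br (J y) e - wedge y z *\<^sub>R br y e"
    using JJ[of "br y e"] JJ[of z]
    by (simp add: linear_add[OF lin] linear_diff[OF lin] linear_scale[OF lin] Je flip: e_def w_def)
  \<comment> \<open>The brackets with \<open>e\<close> are central and disappear, so only the
    coefficient of \<open>w\<close> survives.\<close>
  moreover have "wedge y (br (J y) (a *\<^sub>R w - b *\<^sub>R br (J y) e - c *\<^sub>R br y e)) = a * wedge y (br (J y) w)"
    for a b c
    by (simp add: wedge_def br_nth algebra_simps)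
  ultimately have "wedge y (br (J y) (\<delta> *\<^sub>R e)) = wedge e z * wedge y (br (J y) w)"
    by simp
  moreover have "wedge y (br (J y) (\<delta> *\<^sub>R e)) = \<delta> * \<delta>"
    by (simp add: \<delta>_def wedge_def br_nth algebra_simps)
  ultimately have "wedge y (br (J y) w) \<noteq> 0" using \<delta> by auto
  then have "wedge y (br (J y) (- w)) \<noteq> 0"
    by (simp add: wedge_def br_nth algebra_simps)
  then show ?thesis unfolding w_def by blast
qed

end

section \<open>The orbit of the standard structure\<close>

lemma lie_automorphisms_inv:
  assumes "\<Phi> \<in> lie_automorphisms b"
  shows "inv \<Phi> \<in> lie_automorphisms b"
proof -
  have \<Phi>: "linear \<Phi>" "bij \<Phi>" "\<And>x y. \<Phi> (b x y) = b (\<Phi> x) (\<Phi> y)"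
    using assms by (auto simp: lie_automorphisms_def)
  note surj = surj_f_inv_f[OF bij_is_surj[OF \<Phi>(2)]] and inj = inv_f_f[OF bij_is_inj[OF \<Phi>(2)]]
  have "inv \<Phi> (b x y) = b (inv \<Phi> x) (inv \<Phi> y)" for x y
    using inj[of "b (inv \<Phi> x) (inv \<Phi> y)"] by (simp add: \<Phi>(3) surj)
  moreover have "linear (inv \<Phi>)"
  proof (rule linearI)
    show "inv \<Phi> (x + y) = inv \<Phi> x + inv \<Phi> y" for x y
      using inj[of "inv \<Phi> x + inv \<Phi> y"] by (simp add: linear_add[OF \<Phi>(1)] surj)
    show "inv \<Phi> (r *\<^sub>R x) = r *\<^sub>R inv \<Phi> x" for r x
      using inj[of "r *\<^sub>R inv \<Phi> x"] by (simp add: linear_scale[OF \<Phi>(1)] surj)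
  qed
  ultimately show ?thesis
    using \<Phi>(2) by (simp add: lie_automorphisms_def bij_imp_bij_inv)
qed

lemma complex_structure_aut_orbit:
  assumes K: "complex_structure b K" and "J \<in> aut_orbit b K"
  shows "complex_structure b J"
proof -
  obtain \<Phi> where \<Phi>: "\<Phi> \<in> lie_automorphisms b" and J: "J = inv \<Phi> \<circ> K \<circ> \<Phi>"
    using assms(2) by (auto simp: aut_orbit_def)
  have hom: "linear \<Phi>" "bij \<Phi>" "\<And>x y. \<Phi> (b x y) = b (\<Phi> x) (\<Phi> y)"
    using \<Phi> by (auto simp: lie_automorphisms_def)
  have lini: "linear (inv \<Phi>)"
    using lie_automorphisms_inv[OF \<Phi>] by (simp add: lie_automorphisms_def)
  have \<Phi>J: "\<Phi> (J x) = K (\<Phi> x)" for x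
    by (simp add: J surj_f_inv_f[OF bij_is_surj[OF hom(2)]])
  have inj: "\<Phi> u = \<Phi> v \<Longrightarrow> u = v" for u v
    using bij_is_inj[OF hom(2)] by (simp add: inj_eq)
  have "linear J"
    unfolding J using K lini hom(1) by (auto simp: complex_structure_def intro: linear_compose)
  moreover have "J (J x) = - x" for x
    by (rule inj) (use K in \<open>simp add: \<Phi>J linear_neg[OF hom(1)] complex_structure_def\<close>)
  moreover have "b (J x) (J y) - b x y - J (b (J x) y) - J (b x (J y)) = 0" for x y
    by (rule inj)
      (use K in \<open>simp add: \<Phi>J linear_diff[OF hom(1)] linear_0[OF hom(1)] hom(3) complex_structure_def\<close>)
  ultimately show ?thesis by (simp add: complex_structure_def)
qed

lemma complex_structure_J0: "complex_structure br J0"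
proof -
  have nth: "J0 v $ 1 = - v $ 2" "J0 v $ 2 = v $ 1" "J0 v $ 3 = - v $ 4" "J0 v $ 4 = v $ 3"
    "J0 v $ 5 = - v $ 6" "J0 v $ 6 = v $ 5" for v
  proof -
    have lin: "linear J0" unfolding J0_def by simp
    have J0_eq: "J0 = (\<lambda>v. v $ 1 *\<^sub>R \<x> 2 - v $ 2 *\<^sub>R \<x> 1 + v $ 3 *\<^sub>R \<x> 4 - v $ 4 *\<^sub>R \<x> 3
        + v $ 5 *\<^sub>R \<x> 6 - v $ 6 *\<^sub>R \<x> 5)"
      by (rule linear_eq_6[OF lin], rule linearI) (simp_all add: J0_basis basis_nth algebra_simps)
    show "J0 v $ 1 = - v $ 2" "J0 v $ 2 = v $ 1" "J0 v $ 3 = - v $ 4" "J0 v $ 4 = v $ 3"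
      "J0 v $ 5 = - v $ 6" "J0 v $ 6 = v $ 5"
      by (simp_all add: J0_eq basis_nth)
  qed
  have "linear J0" unfolding J0_def by simp
  then show ?thesis
    by (simp add: complex_structure_def vec6_eq_iff nth br_nth algebra_simps)
qed

lemma frame_automorphism:
  assumes "inj (frame y1 y2 y3)"
  shows "frame y1 y2 y3 \<in> lie_automorphisms br"
  using assms linear_inj_imp_surj[OF linear_frame assms]
  by (simp add: lie_automorphisms_def linear_frame frame_br bij_def)

lemma aut_orbit_J0: "aut_orbit br J0 = {J. complex_structure br J}"
proof (intro equalityI subsetI)
  fix J assume "J \<in> aut_orbit br J0"
  then show "J \<in> {J. complex_structure br J}"
    using complex_structure_aut_orbit[OF complex_structure_J0] by simp
next
  fix J assume "J \<in> {J. complex_structure br J}"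
  then interpret g63_complex_structure J by unfold_locales simp
  obtain y where y: "wedge y (br (J y) (- J (br y (J y)))) \<noteq> 0"
    using ex_generator by blast
  define \<Psi> where "\<Psi> = frame y (J y) (- J (br y (J y)))"
  have \<Psi>: "\<Psi> \<in> lie_automorphisms br"
    unfolding \<Psi>_def by (rule frame_automorphism[OF inj_frame[OF y]])
  then have bij: "bij \<Psi>" by (simp add: lie_automorphisms_def)
  \<comment> \<open>Orbits are formed by \<open>inv \<Phi> \<circ> J0 \<circ> \<Phi>\<close>,
    whereas \<open>\<Psi>\<close> carries \<open>J0\<close> to \<open>J\<close>; hence
    \<open>\<Phi>\<close> is \<open>inv \<Psi>\<close>.\<close>
  have "J = inv (inv \<Psi>) \<circ> J0 \<circ> inv \<Psi>"
  proof
    fix v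
    have "J (\<Psi> (inv \<Psi> v)) = \<Psi> (J0 (inv \<Psi> v))"
      unfolding \<Psi>_def by (rule J_frame) simp_all
    then show "J v = (inv (inv \<Psi>) \<circ> J0 \<circ> inv \<Psi>) v"
      by (simp add: surj_f_inv_f[OF bij_is_surj[OF bij]] inv_inv_eq[OF bij])
  qed
  then show "J \<in> aut_orbit br J0"
    using lie_automorphisms_inv[OF \<Psi>] by (auto simp: aut_orbit_def)
qed

lemma complex_structure_equivalent_J0:
  assumes "complex_structure br J"
  shows "equivalent_structures br J J0"
  using assms complex_structure_J0 aut_orbit_J0 by (auto simp: equivalent_structures_def)

section \<open>Slice charts\<close>

lemma X63_iff: "A \<in> X63 \<longleftrightarrow> complex_structure br ((*v) A)"
proof
  assume "A \<in> X63"
  then obtain J where "complex_structure br J" "A = matrix J" by (auto simp: X63_def)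
  moreover from this have "(*v) A = J"
    by (simp add: complex_structure_def fun_eq_iff)
  ultimately show "complex_structure br ((*v) A)" by simp
next
  assume "complex_structure br ((*v) A)"
  then show "A \<in> X63"
    unfolding X63_def by (intro image_eqI[of _ _ "(*v) A"]) simp_all
qed

lemma matrix_eq_6:
  fixes A B :: "real ^ 6 ^ 'n::finite"
  assumes "A *v \<x> 1 = B *v \<x> 1" "A *v \<x> 2 = B *v \<x> 2" "A *v \<x> 3 = B *v \<x> 3"
    and "A *v \<x> 4 = B *v \<x> 4" "A *v \<x> 5 = B *v \<x> 5" "A *v \<x> 6 = B *v \<x> 6"
  shows "A = B"
  using linear_eq_6[of "(*v) A" "(*v) B"] assms by (simp add: matrix_eq)

definition frame_mat :: "real ^ 6 \<Rightarrow> real ^ 6 \<Rightarrow> real ^ 6 \<Rightarrow> real ^ 6 ^ 6" where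
  "frame_mat y1 y2 y3 = matrix (frame y1 y2 y3)"

lemma frame_mat_mult [simp]: "frame_mat y1 y2 y3 *v v = frame y1 y2 y3 v"
  by (simp add: frame_mat_def linear_frame)

lemma smooth_on_frame_mat:
  assumes "open S" "smooth_on f S" "smooth_on g S"
  shows "smooth_on (\<lambda>x. frame_mat y (f x) (g x)) S"
proof (rule smooth_on_vec[OF \<open>open S\<close>], rule smooth_on_vec[OF \<open>open S\<close>])
  fix i j :: 6
  have br: "smooth_on (\<lambda>x. br (h x) (k x)) S" if "smooth_on h S" "smooth_on k S" for h k
    by (rule smooth_on_bilinear[OF \<open>open S\<close> bounded_bilinear_br that])
  have "smooth_on (\<lambda>x. frame y (f x) (g x) (axis j 1) $ i) S"
    unfolding frame_def
    by (intro smooth_on_nth[OF assms(1)] smooth_on_add[OF assms(1)] br assms(2,3) smooth_on_const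
        smooth_on_linear[OF assms(1) bounded_linear_scaleR_right])
  then show "smooth_on (\<lambda>x. frame_mat y (f x) (g x) $ i $ j) S"
    by (simp add: frame_mat_def matrix_def)
qed

text \<open>For a complex structure \<open>A\<close>, \<open>adapted y A\<close> intertwines \<open>A\<close> and \<open>J0\<close>.  It is a function of
  \<open>M = A ** adapted y A\<close>, in fact of the columns \<open>M *v \<x> 1 = A *v y\<close> and
  \<open>M *v \<x> 4 = A *v br y (A *v y)\<close> only; \<open>columns14\<close> is that function.  So \<open>A\<close> can be
  recovered from \<open>M\<close>, and in the coordinate \<open>M\<close> the complex structures form the graph
  \<open>M = columns14 y M ** J0_mat\<close> over those two columns.  \<open>chart\<close> is this
  coordinate, sheared so that the graph becomes flat.\<close>

definition adapted :: "real ^ 6 \<Rightarrow> real ^ 6 ^ 6 \<Rightarrow> real ^ 6 ^ 6" where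
  "adapted y A = frame_mat y (A *v y) (- (A *v br y (A *v y)))"

definition columns14 :: "real ^ 6 \<Rightarrow> real ^ 6 ^ 6 \<Rightarrow> real ^ 6 ^ 6" where
  "columns14 y M = frame_mat y (M *v \<x> 1) (- (M *v \<x> 4))"

text \<open>Multiplying by it on the right keeps columns 1 and 4 and clears the others.\<close>

definition proj14 :: "real ^ 6 ^ 6" where
  "proj14 = matrix (\<lambda>v. v $ 1 *\<^sub>R \<x> 1 + v $ 4 *\<^sub>R \<x> 4)"

lemma proj14_mult [simp]: "proj14 *v v = v $ 1 *\<^sub>R \<x> 1 + v $ 4 *\<^sub>R \<x> 4"
proof -
  have "linear (\<lambda>v :: real ^ 6. v $ 1 *\<^sub>R \<x> 1 + v $ 4 *\<^sub>R \<x> 4)"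
    by (rule linearI) (simp_all add: algebra_simps)
  then show ?thesis by (simp add: proj14_def)
qed

definition chart :: "real ^ 6 \<Rightarrow> real ^ 6 ^ 6 \<Rightarrow> real ^ 6 ^ 6" where
  "chart y A = A ** adapted y A - adapted y A ** J0_mat + A ** adapted y A ** proj14"

text \<open>With \<open>F = adapted y A\<close> and \<open>M = chart y A\<close>, both
  \<open>M ** proj14 = A ** F ** proj14\<close> and \<open>F = columns14 y M\<close> hold. Solving
  for \<open>A ** F\<close> and dividing by \<open>F\<close> gives this formula.\<close>

definition chart_inv :: "real ^ 6 \<Rightarrow> real ^ 6 ^ 6 \<Rightarrow> real ^ 6 ^ 6" where
  "chart_inv y M = (M + columns14 y M ** J0_mat - M ** proj14) ** matrix_inv (columns14 y M)"

lemma smooth_on_adapted: "open S \<Longrightarrow> smooth_on (adapted y) S"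
proof -
  assume S: "open S"
  note mv = smooth_on_bilinear[OF S bounded_bilinear_matrix_vector_mult]
  show ?thesis
    unfolding adapted_def
    by (intro smooth_on_frame_mat[OF S] mv smooth_on_uminus[OF S] smooth_on_const smooth_on_ident[OF S]
        smooth_on_bilinear[OF S bounded_bilinear_br])
qed

lemma smooth_on_columns14: "open S \<Longrightarrow> smooth_on (columns14 y) S"
proof -
  assume S: "open S"
  note mv = smooth_on_bilinear[OF S bounded_bilinear_matrix_vector_mult]
  show ?thesis
    unfolding columns14_def
    by (intro smooth_on_frame_mat[OF S] mv smooth_on_uminus[OF S] smooth_on_const smooth_on_ident[OF S])
qed

lemma open_det_nz:
  fixes F :: "'a::real_normed_vector \<Rightarrow> real ^ 'n ^ 'n::finite"
  assumes "smooth_on F UNIV"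
  shows "open {x. det (F x) \<noteq> 0}"
proof -
  have "smooth_on (\<lambda>x. det (F x)) UNIV"
    by (intro smooth_on_det smooth_on_nth[OF open_UNIV] assms open_UNIV)
  from smooth_on_imp_continuous_on[OF this] show ?thesis
    by (intro open_Collect_neq continuous_on_const)
qed

lemma smooth_on_chart: "open S \<Longrightarrow> smooth_on (chart y) S"
proof -
  assume S: "open S"
  note mm = smooth_on_bilinear[OF S bounded_bilinear_matrix_mult]
  show ?thesis
    unfolding chart_def
    by (intro smooth_on_add[OF S] smooth_on_diff[OF S] mm smooth_on_const smooth_on_ident[OF S]
        smooth_on_adapted[OF S])
qed

lemma smooth_on_chart_inv:
  assumes S: "open S" and nz: "\<And>M. M \<in> S \<Longrightarrow> det (columns14 y M) \<noteq> 0"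
  shows "smooth_on (chart_inv y) S"
proof -
  note mm = smooth_on_bilinear[OF S bounded_bilinear_matrix_mult]
  show ?thesis
    unfolding chart_inv_def
    by (intro smooth_on_add[OF S] smooth_on_diff[OF S] mm smooth_on_const smooth_on_ident[OF S]
        smooth_on_columns14[OF S] smooth_on_matrix_inv[OF S] nz)
qed

lemma J0_mat_mult_basis:
  "J0_mat *v \<x> 1 = \<x> 2" "J0_mat *v \<x> 2 = - \<x> 1" "J0_mat *v \<x> 3 = \<x> 4"
  "J0_mat *v \<x> 4 = - \<x> 3" "J0_mat *v \<x> 5 = \<x> 6" "J0_mat *v \<x> 6 = - \<x> 5"
  using J0_basis by (simp_all add: J0_def)

lemmas mult_basis_simps =
  matrix_vector_mult_add_rdistrib matrix_vector_mult_diff_rdistrib J0_mat_mult_basis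
  frame_basis linear_neg[OF linear_frame] basis_nth

text \<open>For every \<open>A\<close>, columns 1 and 4 of
  \<open>A ** adapted y A - adapted y A ** J0_mat\<close> vanish by the choice of the frame; the
  \<open>proj14\<close> term of \<open>chart\<close> puts those of \<open>A ** adapted y A\<close>
  back.\<close>

lemma columns14_chart: "columns14 y (chart y A) = adapted y A"
proof -
  have "chart y A *v \<x> 1 = A *v y" "chart y A *v \<x> 4 = A *v br y (A *v y)"
    by (simp_all add: chart_def adapted_def mult_basis_simps flip: matrix_vector_mul_assoc)
  then show ?thesis by (simp add: columns14_def adapted_def)
qed

lemma chart_inv_mult_columns14:
  assumes "det (columns14 y M) \<noteq> 0"
  shows "chart_inv y M ** columns14 y M = M + columns14 y M ** J0_mat - M ** proj14"
  unfolding chart_inv_def by (simp add: matrix_inv_mult[OF assms] flip: matrix_mul_assoc)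

lemma adapted_chart_inv:
  assumes nz: "det (columns14 y M) \<noteq> 0"
  shows "adapted y (chart_inv y M) = columns14 y M"
proof -
  have *: "chart_inv y M *v frame y (M *v \<x> 1) (- (M *v \<x> 4)) v
      = (M + columns14 y M ** J0_mat - M ** proj14) *v v" for v
    unfolding chart_inv_mult_columns14[OF nz, symmetric]
    by (simp add: columns14_def flip: matrix_vector_mul_assoc)
  \<comment> \<open>On columns 1 and 4 the terms \<open>M\<close> and \<open>M ** proj14\<close>
    cancel; what remains is a column of \<open>columns14 y M ** J0_mat\<close>, which
    \<open>J0\<close> takes from the second or the negated third frame vector.\<close>
  have 1: "chart_inv y M *v y = M *v \<x> 1"
    using *[of "\<x> 1"]
    by (simp add: columns14_def mult_basis_simps flip: matrix_vector_mul_assoc)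
  have 2: "chart_inv y M *v br y (M *v \<x> 1) = M *v \<x> 4"
    using *[of "\<x> 4"]
    by (simp add: columns14_def mult_basis_simps flip: matrix_vector_mul_assoc)
  show ?thesis by (simp add: adapted_def columns14_def 1 2)
qed

lemma chart_mult_proj14: "chart y A ** proj14 = A ** adapted y A ** proj14"
  by (rule matrix_eq_6)
    (simp_all add: chart_def adapted_def mult_basis_simps flip: matrix_vector_mul_assoc)

lemma chart_inv_chart:
  assumes nz: "det (adapted y A) \<noteq> 0"
  shows "chart_inv y (chart y A) = A"
proof -
  have "chart_inv y (chart y A) = (A ** adapted y A) ** matrix_inv (adapted y A)"
    unfolding chart_inv_def columns14_chart chart_mult_proj14 by (simp add: chart_def)
  then show ?thesis
    by (simp add: matrix_inv_mult[OF nz] flip: matrix_mul_assoc)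
qed

lemma chart_chart_inv:
  assumes nz: "det (columns14 y M) \<noteq> 0"
  shows "chart y (chart_inv y M) = M"
  unfolding chart_def adapted_chart_inv[OF nz] chart_inv_mult_columns14[OF nz]
  by (rule matrix_eq_6)
    (simp_all add: columns14_def mult_basis_simps flip: matrix_vector_mul_assoc)

text \<open>By \<open>J_frame\<close> the two sheared terms cancel for a complex structure, leaving
  only the \<open>proj14\<close> term.\<close>

lemma chart_slice:
  assumes "A \<in> X63"
  shows "chart y A ** proj14 = chart y A"
proof -
  interpret g63_complex_structure "(*v) A"
    using assms by unfold_locales (simp add: X63_iff)
  have "A ** adapted y A = adapted y A ** J0_mat"
    using J_frame[of "A *v y" y]
    by (simp add: matrix_eq adapted_def J0_def flip: matrix_vector_mul_assoc)
  then show ?thesis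
    unfolding chart_mult_proj14 by (simp add: chart_def)
qed

text \<open>On the slice, \<open>chart_inv y M\<close> is \<open>J0\<close> conjugated by the
  automorphism \<open>columns14 y M\<close>, hence a complex structure.\<close>

lemma chart_inv_slice:
  assumes nz: "det (columns14 y M) \<noteq> 0" and "M ** proj14 = M"
  shows "chart_inv y M \<in> X63"
proof -
  define \<Phi> where "\<Phi> = frame y (M *v \<x> 1) (- (M *v \<x> 4))"
  have \<Phi>: "(*v) (columns14 y M) = \<Phi>"
    by (simp add: fun_eq_iff columns14_def \<Phi>_def)
  have "inj \<Phi>"
    unfolding \<Phi>[symmetric] using nz det_nz_iff_inj[of "(*v) (columns14 y M)"] by simp
  then have aut: "\<Phi> \<in> lie_automorphisms br"
    unfolding \<Phi>_def by (rule frame_automorphism)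
  then have bij: "bij \<Phi>" by (simp add: lie_automorphisms_def)
  have "chart_inv y M ** columns14 y M = columns14 y M ** J0_mat"
    using chart_inv_mult_columns14[OF nz] assms(2) by simp
  then have "chart_inv y M *v \<Phi> v = \<Phi> (J0 v)" for v
    unfolding \<Phi>[symmetric] J0_def matrix_vector_mul_assoc by simp
  from this[of "inv \<Phi> _"] have "(*v) (chart_inv y M) = inv (inv \<Phi>) \<circ> J0 \<circ> inv \<Phi>"
    by (simp add: fun_eq_iff surj_f_inv_f[OF bij_is_surj[OF bij]] inv_inv_eq[OF bij])
  then have "(*v) (chart_inv y M) \<in> aut_orbit br J0"
    using lie_automorphisms_inv[OF aut] by (auto simp: aut_orbit_def)
  then show ?thesis
    by (simp add: aut_orbit_J0 X63_iff)
qed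

lemma slice_subspace:
  "subspace {M :: real ^ 6 ^ 6. M ** proj14 = M}" "dim {M :: real ^ 6 ^ 6. M ** proj14 = M} = 12"
proof -
  \<comment> \<open>The matrix units in columns 1 and 4: six rows times two columns give dimension
    12.\<close>
  define d :: "(real ^ 6 ^ 6) set" where "d = (\<lambda>(i, j). axis i (axis j 1)) ` (UNIV \<times> {1, 4})"
  have d: "d \<subseteq> Basis" by (auto simp: d_def)
  have "M ** proj14 = M \<longleftrightarrow> (\<forall>i. M $ i $ 2 = 0 \<and> M $ i $ 3 = 0 \<and> M $ i $ 5 = 0 \<and> M $ i $ 6 = 0)"
    for M :: "real ^ 6 ^ 6"
  proof -
    have "(M ** proj14) $ i $ j = (if j = 1 \<or> j = 4 then M $ i $ j else 0)" for i j
    proof -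
      have "(M ** proj14) *v \<x> j = (if j = 1 \<or> j = 4 then M *v \<x> j else 0)"
        by (auto simp: basis_nth simp flip: matrix_vector_mul_assoc)
      then show ?thesis
        by (auto simp: matrix_vector_mult_basis column_def vec_eq_iff split: if_splits)
    qed
    then show ?thesis by (auto simp: vec_eq_iff forall_6)
  qed
  moreover have "(\<forall>b\<in>Basis. b \<notin> d \<longrightarrow> M \<bullet> b = 0)
      \<longleftrightarrow> (\<forall>i. M $ i $ 2 = 0 \<and> M $ i $ 3 = 0 \<and> M $ i $ 5 = 0 \<and> M $ i $ 6 = 0)"
    for M :: "real ^ 6 ^ 6"
  proof -
    have "axis i (axis j (1::real)) \<in> d \<longleftrightarrow> j = 1 \<or> j = 4" for i j
      by (auto simp: d_def axis_eq_axis)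
    then have "(\<forall>b\<in>Basis. b \<notin> d \<longrightarrow> M \<bullet> b = 0) \<longleftrightarrow> (\<forall>i j. \<not> (j = 1 \<or> j = 4) \<longrightarrow> M $ i $ j = 0)"
      by (auto simp: Basis_vec_def inner_axis)
    then show ?thesis
      by (simp add: forall_6)
  qed
  ultimately have eq: "{M :: real ^ 6 ^ 6. M ** proj14 = M} = {M. \<forall>b\<in>Basis. b \<notin> d \<longrightarrow> M \<bullet> b = 0}"
    by blast
  have "inj_on (\<lambda>(i, j). axis i (axis j (1::real)) :: real ^ 6 ^ 6) (UNIV \<times> {1, 4})"
    by (auto simp: inj_on_def axis_eq_axis)
  then have "card d = 12"
    by (simp add: d_def card_image card_cartesian_product)
  then show "dim {M :: real ^ 6 ^ 6. M ** proj14 = M} = 12"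
    unfolding eq using dim_substandard[OF d] by simp
  show "subspace {M :: real ^ 6 ^ 6. M ** proj14 = M}"
    unfolding eq by (rule subspace_substandard)
qed

lemma smooth_submanifold_X63: "smooth_submanifold 12 X63"
  unfolding smooth_submanifold_def
proof
  fix p assume p: "p \<in> X63"
  then interpret g63_complex_structure "(*v) p" by unfold_locales (simp add: X63_iff)
  obtain y where y: "wedge y (br (p *v y) (- (p *v (br y (p *v y))))) \<noteq> 0"
    using ex_generator by blast
  \<comment> \<open>The \<open>y\<close> found for \<open>p\<close> stays admissible wherever this
    determinant is nonzero, an open condition that holds at \<open>p\<close>.\<close>
  define U where "U = {A. det (adapted y A) \<noteq> 0}"
  define V where "V = {M. det (columns14 y M) \<noteq> 0}"
  have "(*v) (adapted y p) = frame y (p *v y) (- (p *v br y (p *v y)))"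
    by (simp add: fun_eq_iff adapted_def)
  then have "inj ((*v) (adapted y p))"
    using inj_frame[OF y] by simp
  then have "p \<in> U"
    using det_nz_iff_inj[of "(*v) (adapted y p)"] by (simp add: U_def)
  have opens: "open U" "open V"
    unfolding U_def V_def by (intro open_det_nz smooth_on_adapted smooth_on_columns14 open_UNIV)+
  have UV: "chart y A \<in> V" if "A \<in> U" for A
    using that by (simp add: U_def V_def columns14_chart)
  have VU: "chart_inv y M \<in> U" if "M \<in> V" for M
    using that by (simp add: U_def V_def adapted_chart_inv)
  have smooth: "smooth_on (chart y) U" "smooth_on (chart_inv y) V"
    using opens by (auto intro: smooth_on_chart smooth_on_chart_inv simp: V_def)
  have "homeomorphism U V (chart y) (chart_inv y)"
    by (rule homeomorphismI)
      (use UV VU smooth in \<open>auto simp: U_def V_def chart_inv_chart chart_chart_inv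
        intro: smooth_on_imp_continuous_on\<close>)
  then have "diffeomorphism U V (chart y) (chart_inv y)"
    using opens smooth by (simp add: diffeomorphism_def)
  moreover have "chart y ` (U \<inter> X63) = V \<inter> {M. M ** proj14 = M}"
  proof (intro equalityI subsetI)
    fix M assume "M \<in> chart y ` (U \<inter> X63)"
    then show "M \<in> V \<inter> {M. M ** proj14 = M}" using UV chart_slice by auto
  next
    fix M assume "M \<in> V \<inter> {M. M ** proj14 = M}"
    then have "M = chart y (chart_inv y M)" "chart_inv y M \<in> U \<inter> X63"
      using VU chart_inv_slice chart_chart_inv by (auto simp: V_def)
    then show "M \<in> chart y ` (U \<inter> X63)" by blast
  qed
  ultimately show "\<exists>(U :: (real ^ 6 ^ 6) set) (V :: (real ^ 6 ^ 6) set) f g L. p \<in> U \<and> diffeomorphism U V f g \<and> subspace L \<and> dim L = 12 \<and>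
      f ` (U \<inter> X63) = V \<inter> L"
    using \<open>p \<in> U\<close> slice_subspace
    by blast
qed

theorem mainTheorem1:
  shows "(\<forall>J. complex_structure g63_bracket J \<longrightarrow> equivalent_structures g63_bracket J J0) \<and>
    X63 = matrix ` aut_orbit g63_bracket J0 \<and>
    smooth_submanifold 12 X63"
  using complex_structure_equivalent_J0 smooth_submanifold_X63
  by (simp add: aut_orbit_J0 X63_def)

end
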